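(* Let $\mathcal V$ be a variety, let $n \geq 2$, and let $f, g$ be functions from $\{1,\dots,n-1\}$ to $\{\rightarrow, \leftarrow, \dashleftarrow\}$ such that, for every $i \leq n-1$, if $f(i) \neq {\leftarrow}$, then $g(i)=f(i)$ (in other words, $f$ and $g$ possibly differ only on those $i$ such that $f(i) = {\leftarrow}$). (1) If $\mathcal V$ realizes the pattern path associated to $f$ by a sequence $s_1, s_2, \dots, s_n$ such that $s_i \dashrightarrow s_j$ for every $i \leq j \leq n$, then $\mathcal V$ realizes the pattern path associated to $g$. (2) If $\mathcal V$ is $2$-locally finite and $\mathcal V$ realizes the pattern path associated to $f$, then $\mathcal V$ realizes the pattern path associated to $g$.
   Context: $\mathbf F_2$ (with universe $F_2$) is the free algebra in $\mathcal V$ generated by two elements $\bar x$ and $\bar z$. For $s \in F_2$, $\hat s$ denotes a binary term $\hat s(x,z)$ whose interpretation in $\mathbf F_2$ under $x \mapsto \bar x$, $z \mapsto \bar z$ is $s$ (unique up to equivalence in $\mathcal V$). The symbol $\approx$ denotes an equation valid in $\mathcal V$. For $s,r \in F_2$, write $s \dashrightarrow r$ (equivalently, $r \dashleftarrow s$) if there is a ternary term $t(x,y,z)$ of $\mathcal V$ such that $\hat s(x,z) \approx t(x,x,z)$ and $t(x,z,z) \approx \hat r(x,z)$ in $\mathcal V$. Write $s \rightarrow r$ (equivalently, $r \leftarrow s$) if such a $t$ can be chosen which satisfies in addition $x \approx t(x,y,x)$. Given $f : \{1,\dots,n-1\} \to \{\rightarrow,\leftarrow,\dashleftarrow\}$,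 a sequence $s_1, \dots, s_n$ of elements of $F_2$ realizes the pattern path associated to $f$ if $s_1 = \bar x$, $s_n = \bar z$ and $s_i \mathrel{f(i)} s_{i+1}$ for every $i<n$. $\mathcal V$ realizes this pattern path if such a sequence exists in $F_2$. $\mathcal V$ is $2$-locally finite if the algebra $\mathbf F_2$ is finite (equivalently, every algebra in $\mathcal V$ generated by $2$ elements is finite). *)

theory Defs
  imports Main
begin

section \<open>Terms and algebras\<close>

text \<open>A similarity type is a partial map from symbols to arities, so that it may be empty.
  All operations are finitary.\<close>

type_synonym 'f signature = "'f \<rightharpoonup> nat"

datatype 'f trm = Var nat | App 'f "'f trm list"

inductive_set trms :: "'f signature \<Rightarrow> nat set \<Rightarrow> 'f trm set"
  for Sg :: "'f signature" and X :: "nat set" where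
  Var: "v \<in> X \<Longrightarrow> Var v \<in> trms Sg X"
| App: "Sg h = Some (length ts) \<Longrightarrow> (\<forall>t\<in>set ts. t \<in> trms Sg X) \<Longrightarrow> App h ts \<in> trms Sg X"

abbreviation nary :: "'f signature \<Rightarrow> nat \<Rightarrow> 'f trm set" where
  "nary Sg k \<equiv> trms Sg {..<k}"

primrec subst :: "(nat \<Rightarrow> 'f trm) \<Rightarrow> 'f trm \<Rightarrow> 'f trm" where
  "subst \<sigma> (Var v) = \<sigma> v"
| "subst \<sigma> (App h ts) = App h (map (subst \<sigma>) ts)"

text \<open>If \<open>t\<close> is a \<open>k\<close>-ary term and \<open>us\<close> has length \<open>k\<close>, then \<open>tapp t us\<close> is
  \<open>t(us ! 0, \<dots>, us ! (k - 1))\<close>; the value of \<open>us ! i\<close> for other \<open>i\<close> is never used.\<close>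

definition tapp :: "'f trm \<Rightarrow> 'f trm list \<Rightarrow> 'f trm" where
  "tapp t us = subst (\<lambda>i. us ! i) t"

record ('f, 'a) algebra =
  universe :: "'a set"
  oper :: "'f \<Rightarrow> 'a list \<Rightarrow> 'a"

text \<open>The values of \<open>oper\<close> on symbols outside the similarity type, on lists of the wrong length
  and on arguments outside the universe are irrelevant.\<close>

definition is_algebra :: "'f signature \<Rightarrow> ('f, 'a) algebra \<Rightarrow> bool" where
  "is_algebra Sg A \<longleftrightarrow> universe A \<noteq> {} \<and>
     (\<forall>h as. Sg h = Some (length as) \<and> set as \<subseteq> universe A \<longrightarrow> oper A h as \<in> universe A)"

primrec eval :: "('f, 'a) algebra \<Rightarrow> (nat \<Rightarrow> 'a) \<Rightarrow> 'f trm \<Rightarrow> 'a" where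
  "eval A \<rho> (Var v) = \<rho> v"
| "eval A \<rho> (App h ts) = oper A h (map (eval A \<rho>) ts)"

definition holds :: "('f, 'a) algebra \<Rightarrow> 'f trm \<Rightarrow> 'f trm \<Rightarrow> bool" where
  "holds A s t \<longleftrightarrow> (\<forall>\<rho>. range \<rho> \<subseteq> universe A \<longrightarrow> eval A \<rho> s = eval A \<rho> t)"

definition valid :: "('f, 'a) algebra set \<Rightarrow> 'f trm \<Rightarrow> 'f trm \<Rightarrow> bool"
    ("_ \<Turnstile> _ \<approx> _" [51, 51, 51] 50) where
  "V \<Turnstile> s \<approx> t \<longleftrightarrow> (\<forall>A\<in>V. holds A s t)"


section \<open>Varieties and free algebras\<close>

definition models :: "'f signature \<Rightarrow> ('f trm \<times> 'f trm) set \<Rightarrow> ('f, 'a) algebra set" where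
  "models Sg E = {A. is_algebra Sg A \<and> (\<forall>(s, t)\<in>E. holds A s t)}"

text \<open>HOL has no class of all algebras, so the members of a variety have their universes in some
  type \<open>'a\<close>. By \<open>valid_models_transfer\<close> below, for \<open>'a = 'f trm set\<close> the equations valid in
  \<open>models Sg E\<close> are those valid in all models of \<open>E\<close>, whatever their universes. For arbitrary \<open>'a\<close>
  they are the equations of the variety generated by the models of \<open>E\<close> inside \<open>'a\<close>, so that a
  theorem with \<open>'a\<close> as a type variable covers all varieties.\<close>

definition variety :: "'f signature \<Rightarrow> ('f, 'a) algebra set \<Rightarrow> bool" where
  "variety Sg V \<longleftrightarrow> (\<exists>E. E \<subseteq> trms Sg UNIV \<times> trms Sg UNIV \<and> V = models Sg E)"

definition teq :: "'f signature \<Rightarrow> ('f, 'a) algebra set \<Rightarrow> nat set \<Rightarrow> ('f trm \<times> 'f trm) set" where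
  "teq Sg V X = {(s, t). s \<in> trms Sg X \<and> t \<in> trms Sg X \<and> V \<Turnstile> s \<approx> t}"

text \<open>The free algebra is the term algebra modulo the equations valid in \<open>V\<close>; that the choice of
  representatives in the operations does not matter is \<open>oper_free_alg\<close>, and that the
  algebra is free is \<open>free_alg_in_models\<close>, \<open>free_alg_generated\<close> and \<open>free_alg_universal\<close>.\<close>

definition free_alg ::
    "'f signature \<Rightarrow> ('f, 'a) algebra set \<Rightarrow> nat set \<Rightarrow> ('f, 'f trm set) algebra" where
  "free_alg Sg V X =
     \<lparr>universe = trms Sg X // teq Sg V X,
      oper = (\<lambda>h cs. teq Sg V X `` {App h (map (\<lambda>c. SOME t. t \<in> c) cs)})\<rparr>"

definition free2 :: "'f signature \<Rightarrow> ('f, 'a) algebra set \<Rightarrow> ('f, 'f trm set) algebra" where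
  "free2 Sg V = free_alg Sg V {..<2}"

definition xbar :: "'f signature \<Rightarrow> ('f, 'a) algebra set \<Rightarrow> 'f trm set" where
  "xbar Sg V = teq Sg V {..<2} `` {Var 0}"

definition zbar :: "'f signature \<Rightarrow> ('f, 'a) algebra set \<Rightarrow> 'f trm set" where
  "zbar Sg V = teq Sg V {..<2} `` {Var 1}"

definition two_locally_finite :: "'f signature \<Rightarrow> ('f, 'a) algebra set \<Rightarrow> bool" where
  "two_locally_finite Sg V \<longleftrightarrow> finite (universe (free2 Sg V))"


section \<open>Arrows and pattern paths\<close>

text \<open>The first argument of the binary term is \<open>Var 0\<close> and is sent to \<open>xbar\<close>, the second one is
  \<open>Var 1\<close> and is sent to \<open>zbar\<close>.\<close>

definition hat :: "'f signature \<Rightarrow> ('f, 'a) algebra set \<Rightarrow> 'f trm set \<Rightarrow> 'f trm" where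
  "hat Sg V s = (SOME u. u \<in> nary Sg 2 \<and>
     eval (free2 Sg V) (\<lambda>i. if i = 0 then xbar Sg V else zbar Sg V) u = s)"

definition joins ::
    "'f signature \<Rightarrow> ('f, 'a) algebra set \<Rightarrow> 'f trm \<Rightarrow> 'f trm set \<Rightarrow> 'f trm set \<Rightarrow> bool" where
  "joins Sg V t s r \<longleftrightarrow> t \<in> nary Sg 3 \<and>
     (let x = Var 0; z = Var 2 in
        V \<Turnstile> tapp (hat Sg V s) [x, z] \<approx> tapp t [x, x, z] \<and>
        V \<Turnstile> tapp t [x, z, z] \<approx> tapp (hat Sg V r) [x, z])"

definition dasharrow ::
    "'f signature \<Rightarrow> ('f, 'a) algebra set \<Rightarrow> 'f trm set \<Rightarrow> 'f trm set \<Rightarrow> bool" where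
  "dasharrow Sg V s r \<longleftrightarrow> (\<exists>t. joins Sg V t s r)"

definition arrow ::
    "'f signature \<Rightarrow> ('f, 'a) algebra set \<Rightarrow> 'f trm set \<Rightarrow> 'f trm set \<Rightarrow> bool" where
  "arrow Sg V s r \<longleftrightarrow> (\<exists>t. joins Sg V t s r \<and>
     (let x = Var 0; y = Var 1 in V \<Turnstile> x \<approx> tapp t [x, y, x]))"

datatype label = To | From | DashFrom

fun step ::
    "'f signature \<Rightarrow> ('f, 'a) algebra set \<Rightarrow> label \<Rightarrow> 'f trm set \<Rightarrow> 'f trm set \<Rightarrow> bool" where
  "step Sg V To s r \<longleftrightarrow> arrow Sg V s r"
| "step Sg V From s r \<longleftrightarrow> arrow Sg V r s"
| "step Sg V DashFrom s r \<longleftrightarrow> dasharrow Sg V r s"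

text \<open>Labellings of \<open>{1, \<dots>, n - 1}\<close> and sequences indexed by \<open>{1, \<dots>, n}\<close> are
  functions on \<open>nat\<close> whose other values are ignored.\<close>

definition realizes_by :: "'f signature \<Rightarrow> ('f, 'a) algebra set \<Rightarrow> nat \<Rightarrow> (nat \<Rightarrow> label) \<Rightarrow>
    (nat \<Rightarrow> 'f trm set) \<Rightarrow> bool" where
  "realizes_by Sg V n f s \<longleftrightarrow>
     (\<forall>i\<in>{1..n}. s i \<in> universe (free2 Sg V)) \<and>
     s 1 = xbar Sg V \<and> s n = zbar Sg V \<and>
     (\<forall>i\<in>{1..<n}. step Sg V (f i) (s i) (s (i + 1)))"

definition realizes ::
    "'f signature \<Rightarrow> ('f, 'a) algebra set \<Rightarrow> nat \<Rightarrow> (nat \<Rightarrow> label) \<Rightarrow> bool" where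
  "realizes Sg V n f \<longleftrightarrow> (\<exists>s. realizes_by Sg V n f s)"


section \<open>The free algebra is free\<close>

lemma eval_subst: "eval A \<rho> (subst \<sigma> t) = eval A (\<lambda>v. eval A \<rho> (\<sigma> v)) t"
  by (induction t) (auto intro!: arg_cong[where f = "oper A _"])

lemma subst_Var: "subst Var t = t"
  by (induction t) (auto intro: map_idI)

lemma eval_in_universe:
  assumes "t \<in> trms Sg X" "is_algebra Sg A" "\<And>v. v \<in> X \<Longrightarrow> \<rho> v \<in> universe A"
  shows "eval A \<rho> t \<in> universe A"
  using assms(1)
proof induction
  case (App h ts)
  have "Sg h = Some (length (map (eval A \<rho>) ts))" "set (map (eval A \<rho>) ts) \<subseteq> universe A"
    using App by auto
  then show ?case using assms(2) unfolding is_algebra_def by (metis eval.simps(2))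
qed (simp add: assms)

lemma eval_cong:
  assumes "t \<in> trms Sg X" "\<And>v. v \<in> X \<Longrightarrow> \<rho> v = \<rho>' v"
  shows "eval A \<rho> t = eval A \<rho>' t"
  using assms(1) by induction (auto simp: assms(2) intro!: arg_cong[where f = "oper A _"])

lemma subst_in_trms:
  assumes "t \<in> trms Sg Y" "\<And>v. v \<in> Y \<Longrightarrow> \<sigma> v \<in> trms Sg X"
  shows "subst \<sigma> t \<in> trms Sg X"
  using assms(1) by induction (auto simp: assms(2) intro!: trms.App)

lemma equiv_teq: "equiv (trms Sg X) (teq Sg V X)"
  by (rule equivI) (auto simp: teq_def refl_on_def sym_def trans_def valid_def holds_def)

lemma class_in_free_alg: "t \<in> trms Sg X \<Longrightarrow> teq Sg V X `` {t} \<in> universe (free_alg Sg V X)"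
  by (simp add: free_alg_def quotientI)

lemma class_rep:
  assumes "c \<in> universe (free_alg Sg V X)"
  shows "(SOME t. t \<in> c) \<in> trms Sg X" "teq Sg V X `` {SOME t. t \<in> c} = c"
proof -
  from assms obtain u where u: "u \<in> trms Sg X" "c = teq Sg V X `` {u}"
    by (auto simp: free_alg_def elim: quotientE)
  then have "u \<in> c" using equiv_class_self[OF equiv_teq] by fast
  then have "(SOME t. t \<in> c) \<in> c" by (rule someI)
  then have r: "(u, SOME t. t \<in> c) \<in> teq Sg V X" using u(2) by blast
  then show "(SOME t. t \<in> c) \<in> trms Sg X" unfolding teq_def by blast
  show "teq Sg V X `` {SOME t. t \<in> c} = c"
    using equiv_class_eq[OF equiv_teq r] u(2) by (rule trans[OF sym, OF _ sym])
qed

lemma oper_free_alg: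
  assumes "Sg h = Some (length ts)" "set ts \<subseteq> trms Sg X"
  shows "oper (free_alg Sg V X) h (map (\<lambda>t. teq Sg V X `` {t}) ts) = teq Sg V X `` {App h ts}"
proof -
  let ?r = "\<lambda>t. SOME u. u \<in> teq Sg V X `` {t}"
  have r: "(t, ?r t) \<in> teq Sg V X" if "t \<in> set ts" for t
  proof -
    have t: "t \<in> trms Sg X" using that assms(2) by blast
    then have "teq Sg V X `` {?r t} = teq Sg V X `` {t}" "?r t \<in> trms Sg X"
      using class_rep[OF class_in_free_alg] by blast+
    then show ?thesis using eq_equiv_class_iff[OF equiv_teq t, of "?r t" V] by simp
  qed
  have "eval A \<rho> (App h ts) = eval A \<rho> (App h (map ?r ts))"
    if "A \<in> V" "range \<rho> \<subseteq> universe A" for A \<rho>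
  proof -
    have "eval A \<rho> t = eval A \<rho> (?r t)" if "t \<in> set ts" for t
      using r[OF that] \<open>A \<in> V\<close> \<open>range \<rho> \<subseteq> universe A\<close>
      unfolding teq_def valid_def holds_def by blast
    then have "map (eval A \<rho>) ts = map (eval A \<rho>) (map ?r ts)"
      by (simp del: Image_singleton_iff)
    then show ?thesis by (simp only: eval.simps)
  qed
  then have "V \<Turnstile> App h ts \<approx> App h (map ?r ts)"
    unfolding valid_def holds_def by (intro ballI allI impI)
  moreover have "?r t \<in> trms Sg X" if "t \<in> set ts" for t
    using r[OF that] unfolding teq_def by blast
  then have "App h ts \<in> trms Sg X" "App h (map ?r ts) \<in> trms Sg X"
    using assms by (auto intro!: trms.App simp del: Image_singleton_iff)
  ultimately have "(App h ts, App h (map ?r ts)) \<in> teq Sg V X" by (simp add: teq_def)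
  from equiv_class_eq[OF equiv_teq this] show ?thesis
    by (simp add: free_alg_def comp_def del: Image_singleton_iff)
qed

lemma is_algebra_free_alg:
  assumes "trms Sg X \<noteq> {}"
  shows "is_algebra Sg (free_alg Sg V X)"
  unfolding is_algebra_def
proof (intro conjI allI impI)
  show "universe (free_alg Sg V X) \<noteq> {}" using assms class_in_free_alg by fastforce
  fix h cs assume *: "Sg h = Some (length cs) \<and> set cs \<subseteq> universe (free_alg Sg V X)"
  then have "App h (map (\<lambda>c. SOME t. t \<in> c) cs) \<in> trms Sg X"
    by (auto intro!: trms.App class_rep(1))
  then show "oper (free_alg Sg V X) h cs \<in> universe (free_alg Sg V X)"
    by (simp add: free_alg_def quotientI)
qed

lemma eval_free_alg:
  assumes "t \<in> trms Sg Y" "\<And>v. v \<in> Y \<Longrightarrow> \<sigma> v \<in> trms Sg X"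
  shows "eval (free_alg Sg V X) (\<lambda>v. teq Sg V X `` {\<sigma> v}) t = teq Sg V X `` {subst \<sigma> t}"
  using assms(1)
proof induction
  case (App h ts)
  have "map (eval (free_alg Sg V X) (\<lambda>v. teq Sg V X `` {\<sigma> v})) ts
      = map (\<lambda>t. teq Sg V X `` {t}) (map (subst \<sigma>) ts)"
    using App by simp
  then have "eval (free_alg Sg V X) (\<lambda>v. teq Sg V X `` {\<sigma> v}) (App h ts)
      = oper (free_alg Sg V X) h (map (\<lambda>t. teq Sg V X `` {t}) (map (subst \<sigma>) ts))"
    by (simp only: eval.simps)
  also have "\<dots> = teq Sg V X `` {App h (map (subst \<sigma>) ts)}"
    using App assms(2) by (intro oper_free_alg) (auto intro: subst_in_trms)
  finally show ?case by simp
qed simp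

lemma valid_subst:
  fixes V :: "('f, 'a) algebra set"
  assumes "V \<Turnstile> s \<approx> t" "\<And>A. A \<in> V \<Longrightarrow> is_algebra Sg A" "\<And>v. \<sigma> v \<in> trms Sg X"
  shows "V \<Turnstile> subst \<sigma> s \<approx> subst \<sigma> t"
  unfolding valid_def holds_def eval_subst
proof (intro ballI allI impI)
  fix A :: "('f, 'a) algebra" and \<rho> :: "nat \<Rightarrow> 'a"
  assume A: "A \<in> V" "range \<rho> \<subseteq> universe A"
  then have "range (\<lambda>v. eval A \<rho> (\<sigma> v)) \<subseteq> universe A"
    using eval_in_universe[OF assms(3) assms(2)] by (auto simp: image_subset_iff)
  then show "eval A (\<lambda>v. eval A \<rho> (\<sigma> v)) s = eval A (\<lambda>v. eval A \<rho> (\<sigma> v)) t"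
    using assms(1) A by (auto simp: valid_def holds_def)
qed

lemma free_alg_in_models:
  fixes V :: "('f, 'a) algebra set"
  assumes E: "E \<subseteq> trms Sg UNIV \<times> trms Sg UNIV" and V: "V = models Sg E" and "trms Sg X \<noteq> {}"
  shows "free_alg Sg V X \<in> models Sg E"
proof -
  let ?F = "free_alg Sg V X"
  have "holds ?F s t" if st: "(s, t) \<in> E" for s t
    unfolding holds_def
  proof (intro allI impI)
    fix \<rho> :: "nat \<Rightarrow> 'f trm set" assume \<rho>: "range \<rho> \<subseteq> universe ?F"
    define \<sigma> where "\<sigma> v = (SOME t. t \<in> \<rho> v)" for v
    have \<sigma>: "\<sigma> v \<in> trms Sg X" "teq Sg V X `` {\<sigma> v} = \<rho> v" for v
      using class_rep[of "\<rho> v" Sg V X] \<rho> unfolding \<sigma>_def by blast+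
    have "V \<Turnstile> s \<approx> t" using st by (auto simp: V models_def valid_def)
    then have "V \<Turnstile> subst \<sigma> s \<approx> subst \<sigma> t"
      by (rule valid_subst[where X = X]) (use \<sigma>(1) in \<open>auto simp: V models_def\<close>)
    moreover have st': "s \<in> trms Sg UNIV" "t \<in> trms Sg UNIV" using st E by auto
    ultimately have "(subst \<sigma> s, subst \<sigma> t) \<in> teq Sg V X"
      by (auto simp: teq_def intro: subst_in_trms \<sigma>)
    from equiv_class_eq[OF equiv_teq this] show "eval ?F \<rho> s = eval ?F \<rho> t"
      using eval_free_alg[where \<sigma> = \<sigma> and V = V, OF st'(1) \<sigma>(1)]
        eval_free_alg[where \<sigma> = \<sigma> and V = V, OF st'(2) \<sigma>(1)]
      by (simp only: \<sigma>(2))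
  qed
  then show ?thesis using is_algebra_free_alg[OF assms(3)] by (auto simp: models_def)
qed

lemma free_alg_generated:
  assumes "c \<in> universe (free_alg Sg V X)"
  shows "\<exists>t\<in>trms Sg X. eval (free_alg Sg V X) (\<lambda>v. teq Sg V X `` {Var v}) t = c"
proof -
  have "eval (free_alg Sg V X) (\<lambda>v. teq Sg V X `` {Var v}) (SOME t. t \<in> c) = c"
    using eval_free_alg[OF class_rep(1)[OF assms], where \<sigma> = Var and V = V and X = X]
      class_rep(2)[OF assms] by (simp add: subst_Var trms.Var)
  then show ?thesis using class_rep(1)[OF assms] by (rule bexI)
qed

lemma free_alg_universal:
  assumes A: "A \<in> V" "is_algebra Sg A" and \<rho>: "\<And>v. v \<in> X \<Longrightarrow> \<rho> v \<in> universe A"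
  shows "\<exists>\<phi>. (\<forall>c\<in>universe (free_alg Sg V X). \<phi> c \<in> universe A) \<and>
    (\<forall>v\<in>X. \<phi> (teq Sg V X `` {Var v}) = \<rho> v) \<and>
    (\<forall>h cs. Sg h = Some (length cs) \<and> set cs \<subseteq> universe (free_alg Sg V X) \<longrightarrow>
      \<phi> (oper (free_alg Sg V X) h cs) = oper A h (map \<phi> cs))"
proof -
  define \<phi> where "\<phi> c = eval A \<rho> (SOME t. t \<in> c)" for c
  obtain a where a: "a \<in> universe A" using A(2) by (auto simp: is_algebra_def)
  define \<rho>' where "\<rho>' v = (if v \<in> X then \<rho> v else a)" for v
  have \<rho>': "range \<rho>' \<subseteq> universe A" using a \<rho> by (auto simp: \<rho>'_def)
  have ev: "eval A \<rho> t = eval A \<rho>' t" if "t \<in> trms Sg X" for t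
    using that by (rule eval_cong) (simp add: \<rho>'_def)
  have cl: "\<phi> (teq Sg V X `` {t}) = eval A \<rho> t" if t: "t \<in> trms Sg X" for t
  proof -
    let ?u = "SOME u. u \<in> teq Sg V X `` {t}"
    have u: "?u \<in> trms Sg X" "teq Sg V X `` {?u} = teq Sg V X `` {t}"
      using class_rep[OF class_in_free_alg[OF t]] by auto
    then have "(?u, t) \<in> teq Sg V X" using t equiv_teq eq_equiv_class_iff by metis
    then have "eval A \<rho>' ?u = eval A \<rho>' t"
      using A(1) \<rho>' by (auto simp: teq_def valid_def holds_def)
    then show ?thesis using ev t u by (simp add: \<phi>_def)
  qed
  have "\<phi> c \<in> universe A" if "c \<in> universe (free_alg Sg V X)" for c
    using class_rep(1)[OF that] A(2) \<rho> unfolding \<phi>_def by (auto intro: eval_in_universe)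
  moreover have "\<phi> (teq Sg V X `` {Var v}) = \<rho> v" if "v \<in> X" for v
    using cl[OF trms.Var[OF that]] by simp
  moreover have "\<phi> (oper (free_alg Sg V X) h cs) = oper A h (map \<phi> cs)"
    if "Sg h = Some (length cs)" "set cs \<subseteq> universe (free_alg Sg V X)" for h cs
  proof -
    have "App h (map (\<lambda>c. SOME t. t \<in> c) cs) \<in> trms Sg X"
      using that by (auto intro!: trms.App class_rep(1))
    from cl[OF this] show ?thesis by (simp add: free_alg_def \<phi>_def[abs_def] comp_def)
  qed
  ultimately show ?thesis by blast
qed

lemma valid_models_transfer:
  fixes A :: "('f, 'b) algebra"
  assumes E: "E \<subseteq> trms Sg UNIV \<times> trms Sg UNIV"
    and st: "s \<in> trms Sg UNIV" "t \<in> trms Sg UNIV"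
    and v: "(models Sg E :: ('f, 'f trm set) algebra set) \<Turnstile> s \<approx> t"
    and A: "A \<in> models Sg E"
  shows "holds A s t"
proof -
  let ?V = "models Sg E :: ('f, 'b) algebra set"
  let ?F = "free_alg Sg ?V UNIV"
  have "Var 0 \<in> trms Sg UNIV" by (simp add: trms.Var)
  then have "?F \<in> models Sg E" using free_alg_in_models[OF E refl] by blast
  then have "holds ?F s t" using v by (simp add: valid_def)
  moreover have "range (\<lambda>v. teq Sg ?V UNIV `` {Var v}) \<subseteq> universe ?F"
    by (auto intro!: class_in_free_alg trms.Var)
  ultimately have "eval ?F (\<lambda>v. teq Sg ?V UNIV `` {Var v}) s
      = eval ?F (\<lambda>v. teq Sg ?V UNIV `` {Var v}) t"
    by (simp add: holds_def)
  then have "teq Sg ?V UNIV `` {s} = teq Sg ?V UNIV `` {t}"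
    using eval_free_alg[OF st(1), of Var UNIV ?V] eval_free_alg[OF st(2), of Var UNIV ?V]
    by (simp add: subst_Var trms.Var)
  then have "(s, t) \<in> teq Sg ?V UNIV" using st equiv_teq eq_equiv_class_iff by metis
  then show ?thesis using A by (auto simp: teq_def valid_def)
qed

end

theory Submission
  imports Defs
begin

text \<open>Throughout, \<open>s \<leadsto> r\<close> stands for the dashed arrow from \<open>s\<close> to \<open>r\<close>, and \<open>s \<rightarrow> r\<close> for the solid one.
  Every element \<open>s\<close> of \<open>F\<^sub>2\<close> acts as a binary operation \<open>(v, w) \<mapsto> s(v, w)\<close> on \<open>F\<^sub>2\<close>. The proof rests
  on substituting ternary witnesses into each other. Suppose that \<open>p\<close>, \<open>r\<close> witness \<open>v \<rightarrow> v'\<close> and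
  \<open>w \<rightarrow> w'\<close>, and consider \<open>t(p, q, r)\<close> for an arbitrary ternary \<open>q\<close>. As \<open>p\<close>, \<open>r\<close> and \<open>t\<close> satisfy
  \<open>t(x, y, x) \<approx> x\<close>, so does \<open>t(p, q, r)\<close>, whatever \<open>q\<close> is. If \<open>t\<close> witnesses \<open>s \<rightarrow> s'\<close>
  and \<open>q\<close> witnesses \<open>v \<leadsto> w'\<close>, the result is \<open>s(v, w) \<rightarrow> s'(v', w')\<close> (\<open>arrow_compose\<close>). If instead
  \<open>t\<close> witnesses the backward arrow \<open>s' \<rightarrow> s\<close> and \<open>q\<close> witnesses \<open>w \<leadsto> v'\<close>, the result is again
  the forward arrow \<open>s(v, w) \<rightarrow> s'(v', w')\<close> (\<open>arrow_compose_reversed\<close>).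

  All entries of a realizing sequence are idempotent, \<open>s(x, x) \<approx> x\<close>, because the first one is \<open>x\<close>. An
  idempotent element \<open>s\<close> satisfies \<open>s \<rightarrow> s\<close> and \<open>x \<leadsto> s\<close>.

  For the first claim, let an arrow from \<open>s (k + 1)\<close> back to \<open>s k\<close> be given that is to be reversed. Put
  \<open>v i = s (min i k)\<close> and \<open>w i = s (max i (k + 1))\<close>, and pass to the sequence whose entries are the elements
  \<open>s i\<close> applied to \<open>(v i, w i)\<close>. At \<open>k\<close> both \<open>v\<close> and \<open>w\<close> stand still, and the given arrow itself
  provides \<open>w k = s (k + 1) \<leadsto> s k = v (k + 1)\<close>, so that it gets reversed; all other steps keep their
  labels because \<open>v i \<leadsto> w j\<close> for all \<open>i\<close>, \<open>j\<close>. The new sequence again has dashed arrows from earlier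
  to later entries, so that the arrows can be reversed one at a time (\<open>reverse_one\<close>, \<open>reverse_set\<close>).

  The second claim reduces to the first (\<open>forward_of_finite\<close>). Let \<open>\<phi> i\<close> be the map \<open>q \<mapsto> s\<^sub>i(x, q)\<close>
  on the finite set \<open>F\<^sub>2\<close>. For \<open>m = |F\<^sub>2|!\<close> each power \<open>\<phi> i ^^ m\<close> is an idempotent map. Put
  \<open>r n = z\<close> and \<open>r i = (\<phi> i ^^ m) (r (i + 1))\<close>. Composing with the arrow between \<open>s i\<close> and \<open>s (i + 1)\<close>
  gives, for every idempotent element \<open>q\<close>, an arrow with the same label between \<open>(\<phi> i ^^ m) q\<close> and
  \<open>(\<phi> (i + 1) ^^ m) q\<close>; for \<open>q = r (i + 1)\<close> these are \<open>r i\<close> and \<open>r (i + 1)\<close>. Moreover, for an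
  idempotent element \<open>q\<close>, \<open>p \<leadsto> q\<close> implies \<open>\<phi> i p = s\<^sub>i(x, p) \<leadsto> s\<^sub>i(q, q) = q\<close>, which gives
  \<open>r i \<leadsto> r j\<close> for \<open>i \<le> j\<close>.\<close>


section \<open>Evaluating terms and elements of the free algebra\<close>

text \<open>Values of binary terms (in \<open>Var 0\<close>, \<open>Var 1\<close>) and of ternary terms (in \<open>Var 0\<close>, \<open>Var 1\<close>,
  \<open>Var 2\<close>). Higher variables get the value of the last argument, which keeps all assignments inside
  the universe.\<close>

definition ev2 :: "('f, 'a) algebra \<Rightarrow> 'f trm \<Rightarrow> 'a \<Rightarrow> 'a \<Rightarrow> 'a" where
  "ev2 A t a b = eval A (\<lambda>i. if i = 0 then a else b) t"

definition ev3 :: "('f, 'a) algebra \<Rightarrow> 'f trm \<Rightarrow> 'a \<Rightarrow> 'a \<Rightarrow> 'a \<Rightarrow> 'a" where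
  "ev3 A t a b c = eval A (\<lambda>i. if i = 0 then a else if i = 1 then b else c) t"

text \<open>The term \<open>t(p, q, r)\<close>.\<close>

definition subst3 :: "'f trm \<Rightarrow> 'f trm \<Rightarrow> 'f trm \<Rightarrow> 'f trm \<Rightarrow> 'f trm" where
  "subst3 t p q r = subst (\<lambda>i. if i = 0 then p else if i = 1 then q else r) t"

lemma subst3_nary: "subst3 t p q r \<in> nary Sg k"
  if "t \<in> nary Sg 3" "p \<in> nary Sg k" "q \<in> nary Sg k" "r \<in> nary Sg k"
  using that(1) unfolding subst3_def by (rule subst_in_trms) (use that in auto)

lemma ev3_subst3:
  "ev3 A (subst3 t p q r) a b c = ev3 A t (ev3 A p a b c) (ev3 A q a b c) (ev3 A r a b c)"
  unfolding subst3_def ev3_def eval_subst by (rule arg_cong[where f = "\<lambda>\<rho>. eval A \<rho> t"]) auto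

lemma eval_tapp2: "eval A \<rho> (tapp t [p, q]) = ev2 A t (eval A \<rho> p) (eval A \<rho> q)"
  if "t \<in> nary Sg 2"
  unfolding tapp_def ev2_def eval_subst
  using that by (rule eval_cong) (auto simp: less_2_cases_iff)

lemma eval_tapp3:
  "eval A \<rho> (tapp t [p, q, r]) = ev3 A t (eval A \<rho> p) (eval A \<rho> q) (eval A \<rho> r)"
  if "t \<in> nary Sg 3"
  unfolding tapp_def ev3_def eval_subst
  using that by (rule eval_cong) (auto simp: numeral_3_eq_3 less_Suc_eq)

text \<open>An equation whose two sides depend on two variables only is valid if and only if it holds for all
  pairs of elements. The variables are \<open>Var 0\<close> and \<open>Var i\<close>, with \<open>i = 2\<close> for the equations between
  \<open>x\<close> and \<open>z\<close> and \<open>i = 1\<close> for those between \<open>x\<close> and \<open>y\<close>.\<close>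

lemma valid_iff_assignments:
  assumes "\<And>A \<rho>. A \<in> V \<Longrightarrow> eval A \<rho> p = F A (\<rho> 0) (\<rho> i)"
    and "\<And>A \<rho>. A \<in> V \<Longrightarrow> eval A \<rho> q = G A (\<rho> 0) (\<rho> i)"
    and "i \<noteq> 0"
  shows "V \<Turnstile> p \<approx> q \<longleftrightarrow> (\<forall>A\<in>V. \<forall>a\<in>universe A. \<forall>b\<in>universe A. F A a b = G A a b)"
proof
  assume v: "V \<Turnstile> p \<approx> q"
  show "\<forall>A\<in>V. \<forall>a\<in>universe A. \<forall>b\<in>universe A. F A a b = G A a b"
  proof (intro ballI)
    fix A a b assume A: "A \<in> V" "a \<in> universe A" "b \<in> universe A"
    let ?\<rho> = "\<lambda>j::nat. if j = 0 then a else b"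
    have "range ?\<rho> \<subseteq> universe A" using A by auto
    then have "eval A ?\<rho> p = eval A ?\<rho> q" using v A(1) by (simp add: valid_def holds_def)
    then show "F A a b = G A a b" using assms(1)[OF A(1), of ?\<rho>] assms(2)[OF A(1), of ?\<rho>] assms(3)
      by simp
  qed
next
  assume "\<forall>A\<in>V. \<forall>a\<in>universe A. \<forall>b\<in>universe A. F A a b = G A a b"
  then show "V \<Turnstile> p \<approx> q"
    unfolding valid_def holds_def using assms(1,2) by (metis rangeI subset_iff)
qed

text \<open>Only the fact that the members of \<open>V\<close> are algebras of the given type is needed, not that \<open>V\<close> is
  defined by equations.\<close>

locale algebra_class =
  fixes Sg :: "'f signature" and V :: "('f, 'a) algebra set"
  assumes algebra: "A \<in> V \<Longrightarrow> is_algebra Sg A"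
begin

abbreviation F2 :: "'f trm set set" where
  "F2 \<equiv> universe (free2 Sg V)"

text \<open>The binary term operation of \<open>A\<close> that an element of \<open>F\<^sub>2\<close> stands for.\<close>

definition val :: "'f trm set \<Rightarrow> ('f, 'a) algebra \<Rightarrow> 'a \<Rightarrow> 'a \<Rightarrow> 'a" where
  "val c A a b = ev2 A (hat Sg V c) a b"

text \<open>The element \<open>s(v, w)\<close> of \<open>F\<^sub>2\<close>. It is built from representing terms; by \<open>val_compose\<close> and
  \<open>F2_eqI\<close> their choice does not matter.\<close>

definition compose :: "'f trm set \<Rightarrow> 'f trm set \<Rightarrow> 'f trm set \<Rightarrow> 'f trm set" where
  "compose s v w = teq Sg V {..<2} ``
     {subst (\<lambda>i. if i = 0 then hat Sg V v else hat Sg V w) (hat Sg V s)}"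

lemma ev3_in: "ev3 A t a b c \<in> universe A"
  if "t \<in> nary Sg 3" "A \<in> V" "a \<in> universe A" "b \<in> universe A" "c \<in> universe A"
  unfolding ev3_def using that(1) algebra[OF that(2)] by (rule eval_in_universe) (use that in auto)

lemma hat:
  assumes "c \<in> F2"
  shows "hat Sg V c \<in> nary Sg 2" "teq Sg V {..<2} `` {hat Sg V c} = c"
proof -
  let ?X = "{..<2::nat}"
  have e: "eval (free2 Sg V) (\<lambda>i. if i = 0 then xbar Sg V else zbar Sg V) u = teq Sg V ?X `` {u}"
    if "u \<in> nary Sg 2" for u
  proof -
    have "eval (free2 Sg V) (\<lambda>i. if i = 0 then xbar Sg V else zbar Sg V) u
        = eval (free2 Sg V) (\<lambda>i. teq Sg V ?X `` {Var i}) u"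
      using that by (rule eval_cong) (auto simp: xbar_def zbar_def less_2_cases_iff)
    also have "\<dots> = teq Sg V ?X `` {u}"
      using eval_free_alg[OF that, of Var ?X V] by (simp add: free2_def subst_Var trms.Var)
    finally show ?thesis .
  qed
  have "(SOME t. t \<in> c) \<in> nary Sg 2" "teq Sg V ?X `` {SOME t. t \<in> c} = c"
    using class_rep[of c Sg V ?X] assms by (auto simp: free2_def)
  then have "\<exists>u. u \<in> nary Sg 2 \<and>
      eval (free2 Sg V) (\<lambda>i. if i = 0 then xbar Sg V else zbar Sg V) u = c"
    using e by blast
  from someI_ex[OF this, folded hat_def]
  show "hat Sg V c \<in> nary Sg 2" "teq Sg V ?X `` {hat Sg V c} = c" using e by auto
qed

lemma val_in: "val c A a b \<in> universe A"
  if "c \<in> F2" "A \<in> V" "a \<in> universe A" "b \<in> universe A"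
  unfolding val_def ev2_def using hat(1)[OF that(1)] algebra[OF that(2)]
  by (rule eval_in_universe) (use that in auto)

lemma class_in_F2: "u \<in> nary Sg 2 \<Longrightarrow> teq Sg V {..<2} `` {u} \<in> F2"
  by (simp add: free2_def class_in_free_alg)

lemma class_eq_iff:
  assumes "u \<in> nary Sg 2" "u' \<in> nary Sg 2"
  shows "teq Sg V {..<2} `` {u} = teq Sg V {..<2} `` {u'} \<longleftrightarrow>
    (\<forall>A\<in>V. \<forall>a\<in>universe A. \<forall>b\<in>universe A. ev2 A u a b = ev2 A u' a b)"
proof -
  have "eval A \<rho> v = ev2 A v (\<rho> 0) (\<rho> 1)" if "v \<in> nary Sg 2" for A :: "('f, 'a) algebra" and \<rho> v
    unfolding ev2_def using that by (rule eval_cong) (auto simp: less_2_cases_iff)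
  then have "V \<Turnstile> u \<approx> u' \<longleftrightarrow>
      (\<forall>A\<in>V. \<forall>a\<in>universe A. \<forall>b\<in>universe A. ev2 A u a b = ev2 A u' a b)"
    using assms
    by (intro valid_iff_assignments[where i = 1 and F = "\<lambda>A. ev2 A u" and G = "\<lambda>A. ev2 A u'"]) auto
  moreover have "teq Sg V {..<2} `` {u} = teq Sg V {..<2} `` {u'} \<longleftrightarrow> V \<Turnstile> u \<approx> u'"
    using eq_equiv_class_iff[OF equiv_teq assms, of V] assms by (simp add: teq_def)
  ultimately show ?thesis by simp
qed

lemma val_class: "val (teq Sg V {..<2} `` {u}) A a b = ev2 A u a b"
  if "u \<in> nary Sg 2" "A \<in> V" "a \<in> universe A" "b \<in> universe A"
  using class_eq_iff[OF hat(1)[OF class_in_F2[OF that(1)]] that(1)] hat(2)[OF class_in_F2[OF that(1)]]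
    that unfolding val_def by blast

lemma F2_eqI:
  assumes "c \<in> F2" "d \<in> F2"
    and "\<And>A a b. \<lbrakk>A \<in> V; a \<in> universe A; b \<in> universe A\<rbrakk> \<Longrightarrow> val c A a b = val d A a b"
  shows "c = d"
  using class_eq_iff[OF hat(1)[OF assms(1)] hat(1)[OF assms(2)]] hat(2)[OF assms(1)]
    hat(2)[OF assms(2)] assms(3) unfolding val_def by auto

lemma xbar_in: "xbar Sg V \<in> F2"
  unfolding xbar_def by (rule class_in_F2) (simp add: trms.Var)

lemma zbar_in: "zbar Sg V \<in> F2"
  unfolding zbar_def by (rule class_in_F2) (simp add: trms.Var)

lemma val_xbar: "val (xbar Sg V) A a b = a" if "A \<in> V" "a \<in> universe A" "b \<in> universe A"
  unfolding xbar_def using that by (subst val_class) (auto simp: trms.Var ev2_def)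

lemma val_zbar: "val (zbar Sg V) A a b = b" if "A \<in> V" "a \<in> universe A" "b \<in> universe A"
  unfolding zbar_def using that by (subst val_class) (auto simp: trms.Var ev2_def)

lemma
  assumes "s \<in> F2" "v \<in> F2" "w \<in> F2"
  shows compose_in: "compose s v w \<in> F2"
    and val_compose: "\<lbrakk>A \<in> V; a \<in> universe A; b \<in> universe A\<rbrakk> \<Longrightarrow>
      val (compose s v w) A a b = val s A (val v A a b) (val w A a b)"
proof -
  let ?u = "subst (\<lambda>i. if i = 0 then hat Sg V v else hat Sg V w) (hat Sg V s)"
  have u: "?u \<in> nary Sg 2"
    using hat(1)[OF assms(1)] by (rule subst_in_trms) (use assms hat(1) in auto)
  show "compose s v w \<in> F2" unfolding compose_def using u by (rule class_in_F2)
  assume "A \<in> V" "a \<in> universe A" "b \<in> universe A"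
  from val_class[OF u this] show "val (compose s v w) A a b = val s A (val v A a b) (val w A a b)"
    unfolding compose_def val_def ev2_def eval_subst
    by (simp only: if_distrib[where f = "eval A _"])
qed


section \<open>Arrows between compositions\<close>

text \<open>The term \<open>t\<close> witnesses \<open>s \<leadsto> r\<close>, stated by values in the algebras of \<open>V\<close> instead of by valid
  equations.\<close>

definition connects :: "'f trm \<Rightarrow> 'f trm set \<Rightarrow> 'f trm set \<Rightarrow> bool" where
  "connects t s r \<longleftrightarrow> t \<in> nary Sg 3 \<and>
     (\<forall>A\<in>V. \<forall>a\<in>universe A. \<forall>b\<in>universe A.
        ev3 A t a a b = val s A a b \<and> ev3 A t a b b = val r A a b)"

text \<open>The additional identity \<open>t(x, y, x) \<approx> x\<close> of a witness of \<open>s \<rightarrow> r\<close>.\<close>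

definition absorbing :: "'f trm \<Rightarrow> bool" where
  "absorbing t \<longleftrightarrow> (\<forall>A\<in>V. \<forall>a\<in>universe A. \<forall>b\<in>universe A. ev3 A t a b a = a)"

text \<open>The identity \<open>s(x, x) \<approx> x\<close>.\<close>

definition idem :: "'f trm set \<Rightarrow> bool" where
  "idem s \<longleftrightarrow> (\<forall>A\<in>V. \<forall>a\<in>universe A. val s A a a = a)"

lemma joins_iff: "joins Sg V t s r \<longleftrightarrow> connects t s r" if "s \<in> F2" "r \<in> F2"
proof (cases "t \<in> nary Sg 3")
  case True
  have "V \<Turnstile> tapp (hat Sg V s) [Var 0, Var 2] \<approx> tapp t [Var 0, Var 0, Var 2] \<longleftrightarrow>
      (\<forall>A\<in>V. \<forall>a\<in>universe A. \<forall>b\<in>universe A. val s A a b = ev3 A t a a b)"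
    using True hat(1)[OF that(1)]
    by (intro valid_iff_assignments[where i = 2 and F = "val s" and G = "\<lambda>A a b. ev3 A t a a b"])
      (simp_all add: eval_tapp2 eval_tapp3 val_def)
  moreover have "V \<Turnstile> tapp t [Var 0, Var 2, Var 2] \<approx> tapp (hat Sg V r) [Var 0, Var 2] \<longleftrightarrow>
      (\<forall>A\<in>V. \<forall>a\<in>universe A. \<forall>b\<in>universe A. ev3 A t a b b = val r A a b)"
    using True hat(1)[OF that(2)]
    by (intro valid_iff_assignments[where i = 2 and F = "\<lambda>A a b. ev3 A t a b b" and G = "val r"])
      (simp_all add: eval_tapp2 eval_tapp3 val_def)
  ultimately show ?thesis unfolding joins_def connects_def Let_def by metis
qed (simp add: joins_def connects_def)

lemma dasharrow_iff: "dasharrow Sg V s r \<longleftrightarrow> (\<exists>t. connects t s r)" if "s \<in> F2" "r \<in> F2"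
  unfolding dasharrow_def using that by (simp add: joins_iff)

lemma arrow_iff: "arrow Sg V s r \<longleftrightarrow> (\<exists>t. connects t s r \<and> absorbing t)" if "s \<in> F2" "r \<in> F2"
proof -
  have "V \<Turnstile> Var 0 \<approx> tapp t [Var 0, Var 1, Var 0] \<longleftrightarrow>
      (\<forall>A\<in>V. \<forall>a\<in>universe A. \<forall>b\<in>universe A. a = ev3 A t a b a)" if "t \<in> nary Sg 3" for t
    using that
    by (intro valid_iff_assignments[where i = 1 and F = "\<lambda>A a b. a" and G = "\<lambda>A a b. ev3 A t a b a"])
      (simp_all add: eval_tapp3)
  then have "V \<Turnstile> Var 0 \<approx> tapp t [Var 0, Var 1, Var 0] \<longleftrightarrow> absorbing t" if "t \<in> nary Sg 3" for t
    using that unfolding absorbing_def by metis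
  then show ?thesis unfolding arrow_def Let_def using that
    by (auto simp: joins_iff connects_def)
qed

lemma arrow_imp_dasharrow: "arrow Sg V s r \<Longrightarrow> dasharrow Sg V s r"
  by (auto simp: arrow_def dasharrow_def)

text \<open>If \<open>t\<close> witnesses \<open>s \<leadsto> r\<close>, then \<open>s(x, x) \<approx> t(x, x, x) \<approx> r(x, x)\<close>.\<close>

lemma dasharrow_idem_iff:
  assumes "s \<in> F2" "r \<in> F2" "dasharrow Sg V s r"
  shows "idem s \<longleftrightarrow> idem r"
  using assms dasharrow_iff[OF assms(1,2)] unfolding connects_def idem_def by metis

text \<open>The term \<open>s(x, z)\<close> witnesses \<open>s \<leadsto> s\<close>.\<close>

lemma connects_refl: "\<exists>t. connects t s s \<and> (idem s \<longrightarrow> absorbing t)" if "s \<in> F2"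
proof -
  let ?t = "subst (\<lambda>i. if i = 0 then Var 0 else Var 2) (hat Sg V s)"
  have t: "?t \<in> nary Sg 3"
    using hat(1)[OF that] by (rule subst_in_trms) (auto intro: trms.Var)
  have e: "ev3 A ?t a b c = val s A a c" for A a b c
    unfolding ev3_def val_def ev2_def eval_subst
    by (rule arg_cong[where f = "\<lambda>\<rho>. eval A \<rho> _"]) auto
  show ?thesis by (rule exI[of _ ?t]) (simp add: connects_def absorbing_def idem_def t e)
qed

lemma dasharrow_refl: "s \<in> F2 \<Longrightarrow> dasharrow Sg V s s"
  using connects_refl dasharrow_iff by blast

lemma arrow_refl: "s \<in> F2 \<Longrightarrow> idem s \<Longrightarrow> arrow Sg V s s"
  using connects_refl arrow_iff by blast

text \<open>The term \<open>s(x, y)\<close> is a witness, since \<open>s(x, x) \<approx> x\<close>.\<close>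

lemma xbar_dasharrow: "dasharrow Sg V (xbar Sg V) s" if "s \<in> F2" "idem s"
proof -
  have "hat Sg V s \<in> nary Sg 3"
    using subst_in_trms[OF hat(1)[OF that(1)], of Var "{..<3}"]
    by (simp add: subst_Var trms.Var)
  moreover have "ev3 A (hat Sg V s) a b c = val s A a b" for A :: "('f, 'a) algebra" and a b c
    unfolding ev3_def val_def ev2_def
    using hat(1)[OF that(1)] by (rule eval_cong) (auto simp: less_2_cases_iff)
  ultimately have "connects (hat Sg V s) (xbar Sg V) s"
    using that(2) by (simp add: connects_def idem_def val_xbar)
  then show ?thesis using dasharrow_iff[OF xbar_in that(1)] by blast
qed

text \<open>In the following lemmas the witness is \<open>t(p, q, r)\<close>, where \<open>t\<close>, \<open>p\<close>, \<open>r\<close> witness the arrows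
  between \<open>s\<close> and \<open>s'\<close>, between \<open>v\<close> and \<open>v'\<close>, and between \<open>w\<close> and \<open>w'\<close>. For an arrow from \<open>s\<close> to \<open>s'\<close> one
  has \<open>s(v, w) \<approx> t(v, v, w)\<close> and \<open>s'(v', w') \<approx> t(v', w', w')\<close>, so that \<open>q\<close> has to witness
  \<open>v \<leadsto> w'\<close>.\<close>

lemma dasharrow_compose:
  assumes F2: "s \<in> F2" "s' \<in> F2" "v \<in> F2" "v' \<in> F2" "w \<in> F2" "w' \<in> F2"
    and "dasharrow Sg V s s'" "dasharrow Sg V v v'" "dasharrow Sg V w w'" "dasharrow Sg V v w'"
  shows "dasharrow Sg V (compose s v w) (compose s' v' w')"
proof -
  obtain t p r q where "connects t s s'" "connects p v v'" "connects r w w'" "connects q v w'"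
    using assms by (auto simp: dasharrow_iff)
  then have "connects (subst3 t p q r) (compose s v w) (compose s' v' w')"
    using F2 by (auto simp: connects_def subst3_nary ev3_subst3 val_compose val_in)
  then show ?thesis using dasharrow_iff[OF compose_in[OF F2(1,3,5)] compose_in[OF F2(2,4,6)]] by blast
qed

text \<open>The middle term is unrestricted: \<open>t(p, q, r)(x, y, x) \<approx> t(x, q(x, y, x), x) \<approx> x\<close>.\<close>

lemma absorbing_subst3:
  assumes "absorbing t" "absorbing p" "absorbing r" "q \<in> nary Sg 3"
  shows "absorbing (subst3 t p q r)"
  using assms by (auto simp: absorbing_def ev3_subst3 ev3_in)

lemma arrow_compose:
  assumes F2: "s \<in> F2" "s' \<in> F2" "v \<in> F2" "v' \<in> F2" "w \<in> F2" "w' \<in> F2"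
    and "arrow Sg V s s'" "arrow Sg V v v'" "arrow Sg V w w'" "dasharrow Sg V v w'"
  shows "arrow Sg V (compose s v w) (compose s' v' w')"
proof -
  obtain t p r q where *: "connects t s s'" "connects p v v'" "connects r w w'" "connects q v w'"
      "absorbing t" "absorbing p" "absorbing r"
    using assms by (auto simp: dasharrow_iff arrow_iff)
  then have "connects (subst3 t p q r) (compose s v w) (compose s' v' w')"
    using F2 by (auto simp: connects_def subst3_nary ev3_subst3 val_compose val_in)
  moreover have "absorbing (subst3 t p q r)"
    using * by (intro absorbing_subst3) (auto simp: connects_def)
  ultimately show ?thesis using arrow_iff[OF compose_in[OF F2(1,3,5)] compose_in[OF F2(2,4,6)]] by blast
qed

text \<open>Here \<open>t\<close> witnesses \<open>s' \<rightarrow> s\<close>, hence \<open>s(v, w) \<approx> t(v, w, w)\<close> and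
  \<open>s'(v', w') \<approx> t(v', v', w')\<close>, and \<open>q\<close> has to witness \<open>w \<leadsto> v'\<close>. The arrow between the
  compositions points in the opposite direction to the given one.\<close>

lemma arrow_compose_reversed:
  assumes F2: "s \<in> F2" "s' \<in> F2" "v \<in> F2" "v' \<in> F2" "w \<in> F2" "w' \<in> F2"
    and "arrow Sg V s' s" "arrow Sg V v v'" "arrow Sg V w w'" "dasharrow Sg V w v'"
  shows "arrow Sg V (compose s v w) (compose s' v' w')"
proof -
  obtain t p r q where *: "connects t s' s" "connects p v v'" "connects r w w'" "connects q w v'"
      "absorbing t" "absorbing p" "absorbing r"
    using assms by (auto simp: dasharrow_iff arrow_iff)
  then have "connects (subst3 t p q r) (compose s v w) (compose s' v' w')"
    using F2 by (auto simp: connects_def subst3_nary ev3_subst3 val_compose val_in)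
  moreover have "absorbing (subst3 t p q r)"
    using * by (intro absorbing_subst3) (auto simp: connects_def)
  ultimately show ?thesis using arrow_iff[OF compose_in[OF F2(1,3,5)] compose_in[OF F2(2,4,6)]] by blast
qed

text \<open>The premise \<open>v \<leadsto> w'\<close> serves the label \<open>To\<close>; the premise \<open>v' \<leadsto> w\<close> serves the
  labels \<open>From\<close> and \<open>DashFrom\<close>, for which the roles of the two ends are exchanged.\<close>

lemma step_compose:
  assumes F2: "s \<in> F2" "s' \<in> F2" "v \<in> F2" "v' \<in> F2" "w \<in> F2" "w' \<in> F2"
    and "step Sg V l s s'" "step Sg V l v v'" "step Sg V l w w'"
    and "dasharrow Sg V v w'" "dasharrow Sg V v' w"
  shows "step Sg V l (compose s v w) (compose s' v' w')"
  using assms by (cases l) (simp_all add: arrow_compose dasharrow_compose)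

lemma step_refl: "s \<in> F2 \<Longrightarrow> idem s \<Longrightarrow> step Sg V l s s"
  by (cases l) (simp_all add: arrow_refl dasharrow_refl)

lemma step_idem: "step Sg V l s r \<Longrightarrow> s \<in> F2 \<Longrightarrow> r \<in> F2 \<Longrightarrow> idem s \<Longrightarrow> idem r"
  by (cases l) (auto dest: arrow_imp_dasharrow dasharrow_idem_iff)

lemma idem_xbar: "idem (xbar Sg V)"
  by (simp add: idem_def val_xbar)

lemma idem_zbar: "idem (zbar Sg V)"
  by (simp add: idem_def val_zbar)

lemma idem_compose: "idem (compose s v w)"
  if "s \<in> F2" "v \<in> F2" "w \<in> F2" "idem s" "idem v" "idem w"
  using that by (simp add: idem_def val_compose)

lemma compose_xbar: "compose (xbar Sg V) v w = v" if "v \<in> F2" "w \<in> F2"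
  using that by (intro F2_eqI) (auto simp: compose_in xbar_in val_compose val_xbar val_in)

lemma compose_zbar: "compose (zbar Sg V) v w = w" if "v \<in> F2" "w \<in> F2"
  using that by (intro F2_eqI) (auto simp: compose_in zbar_in val_compose val_zbar val_in)

lemma compose_diag: "compose s v v = v" if "s \<in> F2" "v \<in> F2" "idem s"
  using that by (intro F2_eqI) (auto simp: compose_in val_compose idem_def val_in)

text \<open>Idempotence spreads along the path from its first entry \<open>x\<close>.\<close>

lemma realizes_by_idem:
  assumes "realizes_by Sg V n f s" "1 \<le> i" "i \<le> n"
  shows "idem (s i)"
  using assms(2,3)
proof (induction i rule: dec_induct)
  case base
  then show ?case using assms(1) idem_xbar by (simp add: realizes_by_def)
next
  case (step i)
  then have "step Sg V (f i) (s i) (s (i + 1))" "s i \<in> F2" "s (i + 1) \<in> F2"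
    using assms(1) by (auto simp: realizes_by_def)
  then show ?case using step_idem step by simp
qed


section \<open>Reversing backward arrows\<close>

text \<open>The hypothesis of the first claim: dashed arrows lead from each entry to itself and to all later
  ones.\<close>

definition forward :: "nat \<Rightarrow> (nat \<Rightarrow> 'f trm set) \<Rightarrow> bool" where
  "forward n s \<longleftrightarrow> (\<forall>i j. 1 \<le> i \<and> i \<le> j \<and> j \<le> n \<longrightarrow> dasharrow Sg V (s i) (s j))"

lemma reverse_one:
  assumes r: "realizes_by Sg V n f s" and fw: "forward n s"
    and k: "1 \<le> k" "k < n" "f k = From"
  shows "\<exists>s'. realizes_by Sg V n (f(k := To)) s' \<and> forward n s'"
proof -
  \<comment> \<open>\<open>v\<close> follows \<open>s\<close> up to \<open>k\<close> and then stops; \<open>w\<close> waits at \<open>s (k + 1)\<close> and follows \<open>s\<close> from there on.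
    Hence both are constant between \<open>k\<close> and \<open>k + 1\<close>.\<close>
  define v where "v i = s (min i k)" for i
  define w where "w i = s (max i (k + 1))" for i
  define s' where "s' i = compose (s i) (v i) (w i)" for i
  have sF: "s i \<in> F2" if "1 \<le> i" "i \<le> n" for i using r that by (simp add: realizes_by_def)
  have vF: "v i \<in> F2" if "1 \<le> i" "i \<le> n" for i using sF that k by (simp add: v_def)
  have wF: "w i \<in> F2" if "1 \<le> i" "i \<le> n" for i using sF that k by (simp add: w_def)
  have id: "idem (s i)" if "1 \<le> i" "i \<le> n" for i using realizes_by_idem[OF r] that .
  have dash: "dasharrow Sg V (s i) (s j)" if "1 \<le> i" "i \<le> j" "j \<le> n" for i j
    using fw that unfolding forward_def by blast
  \<comment> \<open>This needs no relation between \<open>i\<close> and \<open>j\<close>, since the indices are at most \<open>k\<close> and at least \<open>k + 1\<close>.\<close>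
  have vw: "dasharrow Sg V (v i) (w j)" if "1 \<le> i" "j \<le> n" for i j
    unfolding v_def w_def by (rule dash) (use that k in auto)
  have st: "step Sg V (f i) (s i) (s (i + 1))" if "1 \<le> i" "i < n" for i
    using r that by (simp add: realizes_by_def)
  have vst: "step Sg V (f i) (v i) (v (i + 1))" if "1 \<le> i" "i < n" "i \<noteq> k" for i
  proof (cases "i < k")
    case True
    then show ?thesis using st[of i] that by (simp add: v_def)
  next
    case False
    then show ?thesis using step_refl[OF sF id, of k "f i"] that k by (simp add: v_def)
  qed
  have wst: "step Sg V (f i) (w i) (w (i + 1))" if "1 \<le> i" "i < n" "i \<noteq> k" for i
  proof (cases "i < k")
    case True
    then show ?thesis using step_refl[OF sF id, of "k + 1" "f i"] that k by (simp add: w_def)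
  next
    case False
    then show ?thesis using st[of i] that by (simp add: w_def max_absorb1)
  qed
  have "step Sg V ((f(k := To)) i) (s' i) (s' (i + 1))" if i: "1 \<le> i" "i < n" for i
  proof (cases "i = k")
    case True
    have "arrow Sg V (s (k + 1)) (s k)" using st[of k] k by simp
    moreover have "arrow Sg V (v k) (v (k + 1))" "arrow Sg V (w k) (w (k + 1))"
      using arrow_refl[OF sF id] k by (auto simp: v_def w_def)
    \<comment> \<open>The arrow being reversed also supplies the middle term of its own reversal.\<close>
    moreover have "dasharrow Sg V (w k) (v (k + 1))"
      using arrow_imp_dasharrow[OF \<open>arrow Sg V (s (k + 1)) (s k)\<close>] by (simp add: v_def w_def)
    ultimately show ?thesis unfolding s'_def using True i
      by (simp add: arrow_compose_reversed sF vF wF)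
  next
    case False
    then show ?thesis unfolding s'_def using i st[OF i] vst[OF i] wst[OF i]
      by (simp add: step_compose sF vF wF vw)
  qed
  moreover have "s' 1 = xbar Sg V"
    using r k compose_xbar[OF vF wF, of 1 1] by (simp add: s'_def v_def realizes_by_def)
  moreover have "s' n = zbar Sg V"
    using r k compose_zbar[OF vF wF, of n n] by (simp add: s'_def w_def realizes_by_def max_absorb1)
  ultimately have "realizes_by Sg V n (f(k := To)) s'"
    unfolding realizes_by_def by (auto simp: s'_def compose_in sF vF wF)
  moreover have "forward n s'"
    unfolding forward_def
  proof (intro allI impI, elim conjE)
    fix i j assume ij: "1 \<le> i" "i \<le> j" "j \<le> n"
    have "dasharrow Sg V (v i) (v j)" unfolding v_def by (rule dash) (use ij k in auto)
    moreover have "dasharrow Sg V (w i) (w j)" unfolding w_def by (rule dash) (use ij k in auto)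
    ultimately show "dasharrow Sg V (s' i) (s' j)"
      unfolding s'_def using ij by (intro dasharrow_compose) (auto intro: sF vF wF vw dash)
  qed
  ultimately show ?thesis by blast
qed

lemma reverse_set:
  assumes "finite K" "K \<subseteq> {i \<in> {1..<n}. f i = From}" "realizes_by Sg V n f s" "forward n s"
  shows "\<exists>s'. realizes_by Sg V n (\<lambda>i. if i \<in> K then To else f i) s' \<and> forward n s'"
  using assms(1,2)
proof (induction K)
  case empty
  then show ?case using assms by auto
next
  case (insert k K)
  then obtain s' where "realizes_by Sg V n (\<lambda>i. if i \<in> K then To else f i) s'" "forward n s'"
    by auto
  from reverse_one[OF this, of k] insert
  obtain s'' where "realizes_by Sg V n ((\<lambda>i. if i \<in> K then To else f i)(k := To)) s''"
      "forward n s''" by auto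
  moreover have "(\<lambda>i. if i \<in> K then To else f i)(k := To)
      = (\<lambda>i. if i \<in> insert k K then To else f i)" by auto
  ultimately show ?case by metis
qed

lemma realizes_of_forward:
  assumes "realizes_by Sg V n f s" "forward n s"
    and fg: "\<forall>i\<in>{1..<n}. f i \<noteq> From \<longrightarrow> g i = f i"
  shows "realizes Sg V n g"
proof -
  \<comment> \<open>At the other differences \<open>g i\<close> is \<open>DashFrom\<close>, which only weakens the label \<open>From\<close>.\<close>
  let ?K = "{i \<in> {1..<n}. f i = From \<and> g i = To}"
  obtain s' where s': "realizes_by Sg V n (\<lambda>i. if i \<in> ?K then To else f i) s'"
    using reverse_set[of ?K n f s] assms(1,2) by auto
  have "step Sg V (g i) (s' i) (s' (i + 1))" if i: "i \<in> {1..<n}" for i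
  proof -
    have "step Sg V (if i \<in> ?K then To else f i) (s' i) (s' (i + 1))"
      using s' i unfolding realizes_by_def by blast
    then show ?thesis
      using i fg by (cases "g i"; cases "f i") (auto intro: arrow_imp_dasharrow)
  qed
  then have "realizes_by Sg V n g s'" using s' by (simp add: realizes_by_def)
  then show ?thesis by (auto simp: realizes_def)
qed

end


section \<open>Straightening a path in a finite free algebra\<close>

text \<open>An orbit in a set with \<open>N\<close> elements becomes periodic after at most \<open>N\<close> steps, with a period of
  at most \<open>N\<close>; the factorial \<open>N!\<close> is a multiple of the period and not less than the preperiod. It does not
  depend on the map, so one exponent serves several maps at once.\<close>

lemma funpow_fact_card_idem:
  assumes A: "finite A" "\<And>a. a \<in> A \<Longrightarrow> \<phi> a \<in> A" "a \<in> A"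
  shows "(\<phi> ^^ fact (card A)) ((\<phi> ^^ fact (card A)) a) = (\<phi> ^^ fact (card A)) a"
proof -
  let ?N = "card A"
  have orbit: "(\<phi> ^^ i) a \<in> A" for i using A by (induction i) auto
  have "card ((\<lambda>i. (\<phi> ^^ i) a) ` {..?N}) \<le> ?N" using orbit A(1) by (intro card_mono) auto
  then have "\<not> inj_on (\<lambda>i. (\<phi> ^^ i) a) {..?N}" using card_image by fastforce
  then obtain i j where ij: "i < j" "j \<le> ?N" "(\<phi> ^^ i) a = (\<phi> ^^ j) a"
    unfolding inj_on_def by (metis atMost_iff linorder_neqE_nat)
  define p where "p = j - i"
  have per: "(\<phi> ^^ (k + p)) a = (\<phi> ^^ k) a" if "i \<le> k" for k
  proof -
    have "(\<phi> ^^ (k + p)) a = (\<phi> ^^ (k - i)) ((\<phi> ^^ j) a)"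
      using that ij(1) by (simp add: p_def funpow_add[symmetric, THEN fun_cong, unfolded comp_def])
    also have "\<dots> = (\<phi> ^^ (k - i)) ((\<phi> ^^ i) a)" using ij(3) by simp
    also have "\<dots> = (\<phi> ^^ k) a"
      using that by (simp add: funpow_add[symmetric, THEN fun_cong, unfolded comp_def])
    finally show ?thesis .
  qed
  have per_mult: "(\<phi> ^^ (k + c * p)) a = (\<phi> ^^ k) a" if "i \<le> k" for k c
  proof (induction c)
    case (Suc c)
    then show ?case using per[of "k + c * p"] that by (simp add: ac_simps)
  qed simp
  have "p dvd fact ?N" using ij by (intro dvd_fact) (auto simp: p_def)
  then obtain c where c: "(fact ?N :: nat) = c * p" by (metis dvdE mult.commute)
  have "i \<le> fact ?N" using ij fact_ge_self[of ?N] by linarith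
  from per_mult[OF this, of c] show ?thesis
    unfolding c[symmetric] by (simp add: funpow_add)
qed

context algebra_class
begin

text \<open>The sequence \<open>r\<close> described at the beginning is \<open>s'\<close> here; \<open>R\<close> enumerates it backwards, starting
  from \<open>r n = z\<close>.\<close>

lemma forward_of_finite:
  assumes fin: "finite F2" and n: "n \<ge> 2" and r: "realizes_by Sg V n f s"
  shows "\<exists>s'. realizes_by Sg V n f s' \<and> forward n s'"
proof -
  let ?x = "xbar Sg V"
  define m :: nat where "m = fact (card F2)"
  define \<phi> where "\<phi> i q = compose (s i) ?x q" for i q
  define R where "R = rec_nat (zbar Sg V) (\<lambda>k q. (\<phi> (n - Suc k) ^^ m) q)"
  define s' where "s' i = R (n - i)" for i
  have sF: "s i \<in> F2" "idem (s i)" if "1 \<le> i" "i \<le> n" for i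
    using r realizes_by_idem[OF r] that by (auto simp: realizes_by_def)
  have it: "(\<phi> i ^^ l) q \<in> F2 \<and> idem ((\<phi> i ^^ l) q)"
    if "1 \<le> i" "i \<le> n" "q \<in> F2" "idem q" for i l q
    using that by (induction l) (auto simp: \<phi>_def compose_in idem_compose xbar_in idem_xbar sF)
  have s'n: "s' n = zbar Sg V" by (simp add: s'_def R_def)
  have s'_rec: "s' i = (\<phi> i ^^ m) (s' (i + 1))" if "i < n" for i
  proof -
    have "n - i = Suc (n - (i + 1))" using that by simp
    then show ?thesis using that by (simp add: s'_def R_def)
  qed
  have s'F: "s' i \<in> F2 \<and> idem (s' i)" if "1 \<le> i" "i \<le> n" for i
    using that(2,1)
  proof (induction i rule: inc_induct)
    case base
    then show ?case by (simp add: s'n zbar_in idem_zbar)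
  next
    case (step i)
    then show ?case using it[of i "s' (i + 1)" m] s'_rec[of i] by simp
  qed
  \<comment> \<open>\<open>s' i\<close> is in the image of an idempotent map, which is the identity in the case \<open>i = n\<close>.\<close>
  have fix_s': "(\<phi> i ^^ m) (s' i) = s' i" if "1 \<le> i" "i \<le> n" for i
  proof (cases "i = n")
    case True
    have "(\<phi> n ^^ l) (zbar Sg V) = zbar Sg V" for l
      using r by (induction l) (auto simp: \<phi>_def realizes_by_def compose_zbar xbar_in zbar_in)
    then show ?thesis by (simp add: True s'n)
  next
    case False
    have "\<phi> i q \<in> F2" if "q \<in> F2" for q
      using that \<open>1 \<le> i\<close> \<open>i \<le> n\<close> by (simp add: \<phi>_def compose_in sF xbar_in)
    then show ?thesis using False that s'_rec[of i] s'F[of "i + 1"]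
        funpow_fact_card_idem[OF fin, of "\<phi> i" "s' (i + 1)"] by (simp add: m_def)
  qed
  have it_step: "step Sg V (f i) ((\<phi> i ^^ l) q) ((\<phi> (i + 1) ^^ l) q)"
    if "1 \<le> i" "i < n" "q \<in> F2" "idem q" for i l q
  proof (induction l)
    case 0
    then show ?case using that by (simp add: step_refl)
  next
    case (Suc l)
    let ?p = "(\<phi> i ^^ l) q" and ?p' = "(\<phi> (i + 1) ^^ l) q"
    have p: "?p \<in> F2" "idem ?p" "?p' \<in> F2" "idem ?p'"
      using it[of i q l] it[of "i + 1" q l] that by auto
    have "step Sg V (f i) (compose (s i) ?x ?p) (compose (s (i + 1)) ?x ?p')"
      using that r p Suc
      by (intro step_compose) (auto simp: realizes_by_def xbar_in step_refl idem_xbar xbar_dasharrow)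
    then show ?case unfolding funpow.simps(2) o_apply by (simp only: \<phi>_def)
  qed
  \<comment> \<open>Apply the preceding fact to \<open>q = s' (i + 1)\<close>, which is a fixed point of the second map.\<close>
  have "step Sg V (f i) (s' i) (s' (i + 1))" if "i \<in> {1..<n}" for i
    using it_step[of i "s' (i + 1)" m] s'_rec[of i] fix_s'[of "i + 1"] s'F[of "i + 1"] that by simp
  moreover have "s' 1 = ?x"
  proof -
    \<comment> \<open>\<open>\<phi> 1\<close> is constant with value \<open>x\<close>, and \<open>m\<close> is positive.\<close>
    have "m = Suc (m - 1)" using fact_gt_zero[of "card F2", where 'a = nat] by (simp add: m_def)
    moreover have "s' 1 = (\<phi> 1 ^^ m) (s' 2)" using s'_rec[of 1] n by (simp add: numeral_2_eq_2)
    ultimately have "s' 1 = \<phi> 1 ((\<phi> 1 ^^ (m - 1)) (s' 2))"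
      by (metis funpow.simps(2) o_apply)
    then show ?thesis
      using r it[of 1 "s' 2" "m - 1"] s'F[of 2] n by (simp add: \<phi>_def realizes_by_def compose_xbar xbar_in)
  qed
  ultimately have "realizes_by Sg V n f s'" using s'F s'n by (simp add: realizes_by_def)
  moreover have "forward n s'"
    unfolding forward_def
  proof (intro allI impI, elim conjE)
    fix i j assume ij: "1 \<le> i" "i \<le> j" "j \<le> n"
    have j: "s' j \<in> F2" "idem (s' j)" using s'F ij by auto
    from ij(2,1) show "dasharrow Sg V (s' i) (s' j)"
    proof (induction i rule: inc_induct)
      case base
      then show ?case using j dasharrow_refl by simp
    next
      case (step i)
      let ?q = "s' (i + 1)"
      have i: "1 \<le> i" "i \<le> n" "i < n" using step ij by auto
      have q: "?q \<in> F2" "idem ?q" using s'F i by auto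
      have "dasharrow Sg V ((\<phi> i ^^ l) ?q) (s' j)" for l
      proof (induction l)
        case 0
        then show ?case using step i by simp
      next
        case (Suc l)
        have "dasharrow Sg V (compose (s i) ?x ((\<phi> i ^^ l) ?q)) (compose (s i) (s' j) (s' j))"
          using Suc it[OF i(1,2) q] i j
          by (intro dasharrow_compose) (auto simp: sF xbar_in dasharrow_refl xbar_dasharrow)
        moreover have "compose (s i) (s' j) (s' j) = s' j" using i j by (simp add: compose_diag sF)
        ultimately show ?case unfolding funpow.simps(2) o_apply by (simp only: \<phi>_def)
      qed
      then show ?case using s'_rec[OF i(3)] by simp
    qed
  qed
  ultimately show ?thesis by blast
qed

end

theorem theorem5p4:
  fixes Sg :: "'f signature" and V :: "('f, 'a) algebra set"
    and n :: nat and f g :: "nat \<Rightarrow> label"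
  assumes "variety Sg V"
    and "n \<ge> 2"
    and "\<forall>i\<in>{1..<n}. f i \<noteq> From \<longrightarrow> g i = f i"
  shows "(\<forall>s. realizes_by Sg V n f s \<and>
              (\<forall>i j. 1 \<le> i \<and> i \<le> j \<and> j \<le> n \<longrightarrow> dasharrow Sg V (s i) (s j))
            \<longrightarrow> realizes Sg V n g)
       \<and> (two_locally_finite Sg V \<and> realizes Sg V n f \<longrightarrow> realizes Sg V n g)"
proof -
  interpret algebra_class Sg V
    by standard (use assms(1) in \<open>auto simp: variety_def models_def\<close>)
  show ?thesis
    using realizes_of_forward[OF _ _ assms(3)] forward_of_finite[OF _ assms(2)]
    unfolding forward_def two_locally_finite_def realizes_def by blast
qed

end
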